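(* Let $C=\{z\in\mathbb{R}^n:Az-b\in K,\ l\le z\le u\}$ be nonempty, and let $z^0$ be a basic feasible solution with index sets $(B^0,N_l^0,N_u^0,N_{fr}^0,\mathcal{A}^0,\bar{\mathcal{A}}^0)$. Apply the pivoting procedure (described in the context) to it, and let $\bar z^0$ and $(B,N_l,N_u,N_{fr},\mathcal{A},\bar{\mathcal{A}})$ be its output. Then $\bar z^0$ is an implicit extreme point of $C$, $\dim(\operatorname{lin}C)=|N_{fr}|$, and the set of vectors $\{v^j\}_{j\in N_{fr}}$ given by $$v^j_k=\begin{cases}-(A_{\mathcal{A}B}^{-1}A_{\mathcal{A},j})_k & k\in B,\\ 0& k\in N_l\cup N_u,\\ 0& k\in N_{fr},\ k\ne j,\\ 1&k=j,\end{cases}$$ is a basis for the lineality space of $C$.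
   Context: $A\in\mathbb{R}^{m\times n}$ has nonzero rows, $b\in\mathbb{R}^m$, $l_j,u_j\in\mathbb{R}\cup\{\pm\infty\}$ with no fixed variables ($l_j<u_j$), $K$ is a Cartesian product of $m$ copies of $\mathbb{R}_+,\{0\},\mathbb{R}_-$. $\operatorname{lin}C$ is the lineality space. A variable $z_j$ is free if $l_j=-\infty$, $u_j=\infty$. A point $z\in C$ is an implicit extreme point of $C$ if $z=\lambda z^1+(1-\lambda)z^2$ with $z^1,z^2\in C$, $\lambda\in(0,1)$ implies $z-z^1,z-z^2\in\operatorname{lin}C$. $A_{\alpha\beta}$ denotes the submatrix with rows $\alpha$, columns $\beta$; the components of $A_{\mathcal{A}B}^{-1}A_{\mathcal{A},j}$ are indexed by $B$. Basic feasible solution with index sets: $\{1,\dots,n\}$ is partitioned into $B$ (basic variables), $N_l$ (nonbasic at finite lower bounds), $N_u$ (nonbasic at finite upper bounds), $N_{fr}$ (nonbasic free variables); $\{1,\dots,m\}$ is partitioned into $\mathcal{A}$ (active constraints, $A_{\mathcal{A}\bullet}z=b_{\mathcal{A}}$) and $\bar{\mathcal{A}}$ (the remaining, "inactive", constraints, whose slacks $s_i=A_{i\bullet}z-b_i$ are basic). The basis matrix $\begin{bmatrix} A_{\mathcal{A}B} & 0 \\ A_{\bar{\mathcal{A}}B} & \pm I \end{bmatrix}$ is invertible, so $|\mathcal{A}|=|B|$ and $A_{\mathcal{A}B}$ is invertible; $z_{N_l}=l_{N_l}$, $z_{N_u}=u_{N_u}$, $z_{N_{fr}}=0$, $z_B=A_{\mathcal{A}B}^{-1}(b_{\mathcal{A}}-A_{\mathcal{A}N}z_N)$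 with $N=N_l\cup N_u\cup N_{fr}$; and $z\in C$. Pivoting procedure: starting from $z^0$ and its index sets, repeat: for each $j\in N_{fr}$, do a simplex ratio test for the nonbasic column $j$ over the basic variables (structural variables and slacks) that are not free; if the ratio is finite, i.e. moving $z_j$ (in some direction, the other basic variables adjusting) is blocked by a bound of a non-free basic variable, pivot $z_j$ into the basis in exchange for the blocking variable, and update the point and index sets (so $|N_{fr}|$ decreases by one). Stop when no $j\in N_{fr}$ can be pivoted in. On termination, for each $j\in N_{fr}$, changing $z_j$ changes only free basic variables. *)

theory Defs
  imports "HOL-Analysis.Analysis"
begin

section \<open>Lineality space and implicit extreme points\<close>

definition recession_cone :: "'a::real_vector set \<Rightarrow> 'a set" where
  "recession_cone C = {d. \<forall>x\<in>C. \<forall>t\<ge>0. x + t *\<^sub>R d \<in> C}"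

definition lineality_space :: "'a::real_vector set \<Rightarrow> 'a set" where
  "lineality_space C = recession_cone C \<inter> uminus ` recession_cone C"

definition implicit_extreme_point :: "'a::real_vector \<Rightarrow> 'a set \<Rightarrow> bool" where
  "implicit_extreme_point z C \<longleftrightarrow> z \<in> C \<and>
     (\<forall>z1\<in>C. \<forall>z2\<in>C. \<forall>t. 0 < t \<and> t < 1 \<and> z = t *\<^sub>R z1 + (1 - t) *\<^sub>R z2 \<longrightarrow>
        z - z1 \<in> lineality_space C \<and> z - z2 \<in> lineality_space C)"

section \<open>Submatrices\<close>

text \<open>
  A vector indexed by a subset of the index type is represented by the full vector that is zero
  outside the subset, and a matrix with row set \<open>\<alpha>\<close> and column set \<open>\<beta>\<close> by the full matrix
  that is zero outside \<open>\<alpha> \<times> \<beta>\<close>.  Products and sums of such objects are then the library's.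
  The identity matrix on the index set \<open>\<alpha>\<close> is \<open>submat (mat 1) \<alpha> \<alpha>\<close>.
\<close>

definition subvec :: "real^'n \<Rightarrow> 'n set \<Rightarrow> real^'n" where
  "subvec x \<beta> = (\<chi> k. if k \<in> \<beta> then x $ k else 0)"

definition submat :: "real^'n^'m \<Rightarrow> 'm set \<Rightarrow> 'n set \<Rightarrow> real^'n^'m" where
  "submat M \<alpha> \<beta> = (\<chi> i k. if i \<in> \<alpha> \<and> k \<in> \<beta> then M $ i $ k else 0)"

text \<open>
  \<open>W\<close> is the two-sided inverse of the submatrix of \<open>M\<close> with rows \<open>\<alpha>\<close> and columns \<open>\<beta>\<close>;
  its own rows are indexed by \<open>\<beta>\<close> and its columns by \<open>\<alpha>\<close>.
\<close>

definition is_submat_inv :: "real^'n^'m \<Rightarrow> 'm set \<Rightarrow> 'n set \<Rightarrow> real^'m^'n \<Rightarrow> bool" where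
  "is_submat_inv M \<alpha> \<beta> W \<longleftrightarrow>
     submat W \<beta> \<alpha> = W \<and>
     submat M \<alpha> \<beta> ** W = submat (mat 1) \<alpha> \<alpha> \<and>
     W ** submat M \<alpha> \<beta> = submat (mat 1) \<beta> \<beta>"

definition submat_invertible :: "real^'n^'m \<Rightarrow> 'm set \<Rightarrow> 'n set \<Rightarrow> bool" where
  "submat_invertible M \<alpha> \<beta> \<longleftrightarrow> (\<exists>W. is_submat_inv M \<alpha> \<beta> W)"

definition submat_inv :: "real^'n^'m \<Rightarrow> 'm set \<Rightarrow> 'n set \<Rightarrow> real^'m^'n" where
  "submat_inv M \<alpha> \<beta> = (THE W. is_submat_inv M \<alpha> \<beta> W)"

lemma submat_mult_id_right:
  assumes "submat W \<beta> \<alpha> = W"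
  shows "W ** submat (mat 1) \<alpha> \<alpha> = W"
proof -
  have "(W ** submat (mat 1) \<alpha> \<alpha>) $ k $ i = W $ k $ i" for k i
  proof -
    have "(W ** submat (mat 1) \<alpha> \<alpha>) $ k $ i
        = (\<Sum>i'\<in>UNIV. if i' = i then (if i \<in> \<alpha> then W $ k $ i else 0) else 0)"
      unfolding matrix_matrix_mult_def vec_lambda_beta
      by (intro sum.cong refl) (auto simp: submat_def mat_def)
    also have "\<dots> = submat W \<beta> \<alpha> $ k $ i"
      using arg_cong[OF assms, of "\<lambda>M. M $ k $ i"] by (simp add: submat_def split: if_splits)
    finally show ?thesis using assms by simp
  qed
  then show ?thesis by (simp add: vec_eq_iff)
qed

lemma submat_mult_id_left:
  assumes "submat W \<beta> \<alpha> = W"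
  shows "submat (mat 1) \<beta> \<beta> ** W = W"
proof -
  have "(submat (mat 1) \<beta> \<beta> ** W) $ k $ i = W $ k $ i" for k i
  proof -
    have "(submat (mat 1) \<beta> \<beta> ** W) $ k $ i
        = (\<Sum>k'\<in>UNIV. if k' = k then (if k \<in> \<beta> then W $ k $ i else 0) else 0)"
      unfolding matrix_matrix_mult_def vec_lambda_beta
      by (intro sum.cong refl) (auto simp: submat_def mat_def)
    also have "\<dots> = submat W \<beta> \<alpha> $ k $ i"
      using arg_cong[OF assms, of "\<lambda>M. M $ k $ i"] by (simp add: submat_def split: if_splits)
    finally show ?thesis using assms by simp
  qed
  then show ?thesis by (simp add: vec_eq_iff)
qed

lemma submat_inv_eqI:
  assumes "is_submat_inv M \<alpha> \<beta> W"
  shows "submat_inv M \<alpha> \<beta> = W"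
  unfolding submat_inv_def
proof (rule the_equality)
  fix V assume V: "is_submat_inv M \<alpha> \<beta> V"
  have "V = V ** (submat M \<alpha> \<beta> ** W)"
    using V assms submat_mult_id_right[of V \<beta> \<alpha>] by (metis is_submat_inv_def)
  also have "\<dots> = W"
    using V assms submat_mult_id_left[of W \<beta> \<alpha>] by (metis is_submat_inv_def matrix_mul_assoc)
  finally show "V = W" .
qed (use assms in simp)

section \<open>The feasible set\<close>

datatype row_sense = RowGe | RowEq | RowLe

fun sense_cone :: "row_sense \<Rightarrow> real set" where
  "sense_cone RowGe = {0..}"
| "sense_cone RowEq = {0}"
| "sense_cone RowLe = {..0}"

definition product_cone :: "('m \<Rightarrow> row_sense) \<Rightarrow> (real^'m) set" where
  "product_cone \<kappa> = {y. \<forall>i. y $ i \<in> sense_cone (\<kappa> i)}"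

definition feasible_set ::
  "real^'n^'m \<Rightarrow> real^'m \<Rightarrow> ('m \<Rightarrow> row_sense) \<Rightarrow> ('n \<Rightarrow> ereal) \<Rightarrow> ('n \<Rightarrow> ereal) \<Rightarrow> (real^'n) set" where
  "feasible_set A b \<kappa> l u =
     {z. A *v z - b \<in> product_cone \<kappa> \<and> (\<forall>j. l j \<le> ereal (z $ j) \<and> ereal (z $ j) \<le> u j)}"

section \<open>Basic feasible solutions\<close>

record ('n, 'm) index_sets =
  basic :: "'n set"
  nb_lower :: "'n set"
  nb_upper :: "'n set"
  nb_free :: "'n set"
  active :: "'m set"
  inactive :: "'m set"

definition nonbasic :: "('n, 'm) index_sets \<Rightarrow> 'n set" where
  "nonbasic I = nb_lower I \<union> nb_upper I \<union> nb_free I"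

definition index_partition :: "('n, 'm) index_sets \<Rightarrow> bool" where
  "index_partition I \<longleftrightarrow>
     basic I \<union> nb_lower I \<union> nb_upper I \<union> nb_free I = UNIV \<and>
     basic I \<inter> nb_lower I = {} \<and> basic I \<inter> nb_upper I = {} \<and> basic I \<inter> nb_free I = {} \<and>
     nb_lower I \<inter> nb_upper I = {} \<and> nb_lower I \<inter> nb_free I = {} \<and> nb_upper I \<inter> nb_free I = {} \<and>
     active I \<union> inactive I = UNIV \<and> active I \<inter> inactive I = {}"

text \<open>
  The variables of the program are indexed by \<open>'n + 'm\<close>: \<open>Inl j\<close> is the structural variable
  \<open>z\<^sub>j\<close> and \<open>Inr i\<close> the slack \<open>s\<^sub>i\<close>.  Since \<open>A z - s = b\<close>, the coefficient matrix is
  \<open>[A, -I]\<close>; the basis matrix consists of its basic columns, so its rows in \<open>active I\<close> are zero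
  in the slack columns.
\<close>

definition slack_form :: "real^'n^'m \<Rightarrow> real^('n + 'm)^'m" where
  "slack_form A = (\<chi> i x. case x of Inl j \<Rightarrow> A $ i $ j | Inr i' \<Rightarrow> if i' = i then -1 else 0)"

definition basic_vars :: "('n, 'm) index_sets \<Rightarrow> ('n + 'm) set" where
  "basic_vars I = Inl ` basic I \<union> Inr ` inactive I"

definition basis_matrix_invertible :: "real^'n^'m \<Rightarrow> ('n, 'm) index_sets \<Rightarrow> bool" where
  "basis_matrix_invertible A I \<longleftrightarrow> submat_invertible (slack_form A) UNIV (basic_vars I)"

definition basic_feasible_solution ::
  "real^'n^'m \<Rightarrow> real^'m \<Rightarrow> ('m \<Rightarrow> row_sense) \<Rightarrow> ('n \<Rightarrow> ereal) \<Rightarrow> ('n \<Rightarrow> ereal) \<Rightarrow>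
   real^'n \<Rightarrow> ('n, 'm) index_sets \<Rightarrow> bool" where
  "basic_feasible_solution A b \<kappa> l u z I \<longleftrightarrow>
     index_partition I \<and>
     basis_matrix_invertible A I \<and>
     (\<forall>j\<in>nb_lower I. ereal (z $ j) = l j) \<and>
     (\<forall>j\<in>nb_upper I. ereal (z $ j) = u j) \<and>
     (\<forall>j\<in>nb_free I. l j = -\<infinity> \<and> u j = \<infinity> \<and> z $ j = 0) \<and>
     (\<forall>i\<in>active I. (A *v z) $ i = b $ i) \<and>
     subvec z (basic I) = submat_inv A (active I) (basic I) *v
       (subvec b (active I) - submat A (active I) (nonbasic I) *v subvec z (nonbasic I)) \<and>
     z \<in> feasible_set A b \<kappa> l u"

section \<open>The pivoting procedure\<close>

definition free_direction :: "real^'n^'m \<Rightarrow> ('n, 'm) index_sets \<Rightarrow> 'n \<Rightarrow> real^'n" where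
  "free_direction A I j = (\<chi> k.
     if k \<in> basic I then - (submat_inv A (active I) (basic I) *v subvec (column j A) (active I)) $ k
     else if k \<in> nb_lower I \<union> nb_upper I then 0
     else if k \<noteq> j then 0
     else 1)"

fun var_value :: "real^'n^'m \<Rightarrow> real^'m \<Rightarrow> real^'n \<Rightarrow> 'n + 'm \<Rightarrow> real" where
  "var_value A b z (Inl k) = z $ k"
| "var_value A b z (Inr i) = (A *v z - b) $ i"

text \<open>Rate of change of a variable when \<open>z\<close> moves in direction \<open>d\<close>.\<close>

fun var_rate :: "real^'n^'m \<Rightarrow> real^'n \<Rightarrow> 'n + 'm \<Rightarrow> real" where
  "var_rate A d (Inl k) = d $ k"
| "var_rate A d (Inr i) = (A *v d) $ i"

fun var_lower :: "('m \<Rightarrow> row_sense) \<Rightarrow> ('n \<Rightarrow> ereal) \<Rightarrow> 'n + 'm \<Rightarrow> ereal" where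
  "var_lower \<kappa> l (Inl k) = l k"
| "var_lower \<kappa> l (Inr i) = (if \<kappa> i = RowLe then -\<infinity> else 0)"

fun var_upper :: "('m \<Rightarrow> row_sense) \<Rightarrow> ('n \<Rightarrow> ereal) \<Rightarrow> 'n + 'm \<Rightarrow> ereal" where
  "var_upper \<kappa> u (Inl k) = u k"
| "var_upper \<kappa> u (Inr i) = (if \<kappa> i = RowGe then \<infinity> else 0)"

definition nonfree_basic_vars ::
  "('m \<Rightarrow> row_sense) \<Rightarrow> ('n \<Rightarrow> ereal) \<Rightarrow> ('n \<Rightarrow> ereal) \<Rightarrow> ('n, 'm) index_sets \<Rightarrow> ('n + 'm) set" where
  "nonfree_basic_vars \<kappa> l u I =
     {x \<in> basic_vars I. \<not> (var_lower \<kappa> l x = -\<infinity> \<and> var_upper \<kappa> u x = \<infinity>)}"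

text \<open>
  The step length after which a variable with value \<open>w\<close>, bounds \<open>lo\<close> and \<open>hi\<close>, and rate of
  change \<open>r\<close> hits a bound.
\<close>

definition bound_ratio :: "ereal \<Rightarrow> ereal \<Rightarrow> real \<Rightarrow> real \<Rightarrow> ereal" where
  "bound_ratio lo hi w r =
     (if r > 0 then (hi - ereal w) / ereal r
      else if r < 0 then (ereal w - lo) / ereal (- r)
      else \<infinity>)"

definition var_ratio ::
  "real^'n^'m \<Rightarrow> real^'m \<Rightarrow> ('m \<Rightarrow> row_sense) \<Rightarrow> ('n \<Rightarrow> ereal) \<Rightarrow> ('n \<Rightarrow> ereal) \<Rightarrow>
   real^'n \<Rightarrow> real^'n \<Rightarrow> 'n + 'm \<Rightarrow> ereal" where
  "var_ratio A b \<kappa> l u z d x =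
     bound_ratio (var_lower \<kappa> l x) (var_upper \<kappa> u x) (var_value A b z x) (var_rate A d x)"

text \<open>An infimum over the empty set is \<open>\<infinity>\<close>.\<close>

definition ratio_test ::
  "real^'n^'m \<Rightarrow> real^'m \<Rightarrow> ('m \<Rightarrow> row_sense) \<Rightarrow> ('n \<Rightarrow> ereal) \<Rightarrow> ('n \<Rightarrow> ereal) \<Rightarrow>
   ('n, 'm) index_sets \<Rightarrow> real^'n \<Rightarrow> real^'n \<Rightarrow> ereal" where
  "ratio_test A b \<kappa> l u I z d = (INF x\<in>nonfree_basic_vars \<kappa> l u I. var_ratio A b \<kappa> l u z d x)"

text \<open>
  Index sets after the nonbasic free variable \<open>j\<close> has replaced the blocking variable in the basis;
  \<open>r\<close> is the rate of change of the blocking variable, whose sign tells which bound it has reached.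
\<close>

fun exchange :: "('n, 'm) index_sets \<Rightarrow> 'n \<Rightarrow> 'n + 'm \<Rightarrow> real \<Rightarrow> ('n, 'm) index_sets" where
  "exchange I j (Inl k) r =
     I\<lparr>basic := insert j (basic I - {k}),
       nb_lower := (if r < 0 then insert k (nb_lower I) else nb_lower I),
       nb_upper := (if r > 0 then insert k (nb_upper I) else nb_upper I),
       nb_free := nb_free I - {j}\<rparr>"
| "exchange I j (Inr i) r =
     I\<lparr>basic := insert j (basic I),
       nb_free := nb_free I - {j},
       active := insert i (active I),
       inactive := inactive I - {i}\<rparr>"

text \<open>
  The sign \<open>\<sigma>\<close> is the direction in which \<open>z\<^sub>j\<close> is moved.  The entering variable, its direction and,
  in case of ties, the blocking variable are arbitrary.
\<close>

inductive pivot_step ::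
  "real^'n^'m \<Rightarrow> real^'m \<Rightarrow> ('m \<Rightarrow> row_sense) \<Rightarrow> ('n \<Rightarrow> ereal) \<Rightarrow> ('n \<Rightarrow> ereal) \<Rightarrow>
   (real^'n) \<times> ('n, 'm) index_sets \<Rightarrow> (real^'n) \<times> ('n, 'm) index_sets \<Rightarrow> bool"
  for A b \<kappa> l u where
  pivot: "\<lbrakk>j \<in> nb_free I; \<sigma> \<in> {-1, 1}; d = \<sigma> *\<^sub>R free_direction A I j;
           ratio_test A b \<kappa> l u I z d = ereal \<theta>;
           x \<in> nonfree_basic_vars \<kappa> l u I; var_ratio A b \<kappa> l u z d x = ereal \<theta>\<rbrakk>
    \<Longrightarrow> pivot_step A b \<kappa> l u (z, I) (z + \<theta> *\<^sub>R d, exchange I j x (var_rate A d x))"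

definition pivot_output ::
  "real^'n^'m \<Rightarrow> real^'m \<Rightarrow> ('m \<Rightarrow> row_sense) \<Rightarrow> ('n \<Rightarrow> ereal) \<Rightarrow> ('n \<Rightarrow> ereal) \<Rightarrow>
   (real^'n) \<times> ('n, 'm) index_sets \<Rightarrow> (real^'n) \<times> ('n, 'm) index_sets \<Rightarrow> bool" where
  "pivot_output A b \<kappa> l u s s' \<longleftrightarrow>
     (pivot_step A b \<kappa> l u)\<^sup>*\<^sup>* s s' \<and> (\<nexists>s''. pivot_step A b \<kappa> l u s' s'')"

lemma pivot_step_card_nb_free:
  assumes "pivot_step A b \<kappa> l u s s'"
  shows "Suc (card (nb_free (snd s'))) = card (nb_free (snd s))"
  using assms
proof cases
  case (pivot j I \<sigma> d z \<theta> x)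
  have "nb_free (exchange I j x (var_rate A d x)) = nb_free I - {j}"
    by (cases x) simp_all
  moreover have "Suc (card (nb_free I - {j})) = card (nb_free I)"
    by (rule card_Suc_Diff1) (use pivot in auto)
  ultimately show ?thesis using pivot by simp
qed

lemma pivot_output_exists: "\<exists>s'. pivot_output A b \<kappa> l u s s'"
proof (induction "card (nb_free (snd s))" arbitrary: s rule: less_induct)
  case less
  show ?case
  proof (cases "\<exists>s1. pivot_step A b \<kappa> l u s s1")
    case True
    then obtain s1 where s1: "pivot_step A b \<kappa> l u s s1" by blast
    then obtain s' where "pivot_output A b \<kappa> l u s1 s'"
      using less pivot_step_card_nb_free[OF s1] by (metis lessI)
    with s1 show ?thesis
      unfolding pivot_output_def by (meson converse_rtranclp_into_rtranclp)
  next
    case False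
    then show ?thesis unfolding pivot_output_def by blast
  qed
qed

end

theory Submission
  imports Defs
begin

text \<open>
  Structural variables and slacks are treated alike: \<open>d\<close> extends to the vector of rates of all
  variables, which is the general solution of the homogeneous system in slack form.  A pivot is then a
  basis exchange that keeps the point feasible and every nonbasic variable that is not free at one
  of its bounds.  A vector whose rates vanish on those nonbasic variables is a combination of the
  free directions.  On termination no free direction changes a variable that has a bound (otherwise the
  ratio test, for a suitable sign, would be finite), so the free directions lie in the lineality
  space, which consists of the vectors with zero rate on all variables that have a bound.
  If \<open>z\<close> is a convex combination of \<open>z1\<close> and \<open>z2\<close> in \<open>C\<close>, the variables at a bound agree in all three points,
  hence the differences are again combinations of the free directions.
\<close>

section \<open>Unique solvability of submatrix systems\<close>

text \<open>Invertibility of the submatrix, phrased with vectors supported on \<open>\<beta>\<close>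
  and equations on the rows \<open>\<alpha>\<close>. In this form a basis exchange is proved by
  modifying solutions, without computing an inverse matrix.\<close>

definition uniquely_solvable :: "real^'n^'m \<Rightarrow> 'm set \<Rightarrow> 'n set \<Rightarrow> bool" where
  "uniquely_solvable M \<alpha> \<beta> \<longleftrightarrow>
     (\<forall>y. \<exists>x. (\<forall>k. k \<notin> \<beta> \<longrightarrow> x $ k = 0) \<and> (\<forall>i\<in>\<alpha>. (M *v x) $ i = y $ i)) \<and>
     (\<forall>x. (\<forall>k. k \<notin> \<beta> \<longrightarrow> x $ k = 0) \<and> (\<forall>i\<in>\<alpha>. (M *v x) $ i = 0) \<longrightarrow> x = 0)"

lemma submat_mult_vec_nth:
  assumes "\<And>k. k \<notin> \<beta> \<Longrightarrow> x $ k = 0"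
  shows "(submat M \<alpha> \<beta> *v x) $ i = (if i \<in> \<alpha> then (M *v x) $ i else 0)"
  using assms by (auto simp: matrix_vector_mult_def submat_def intro!: sum.cong)

lemma submat_id_mult_vec: "submat (mat 1) \<alpha> \<alpha> *v x = subvec x \<alpha>"
proof -
  have "(submat (mat 1) \<alpha> \<alpha> *v x) $ i = (\<Sum>k\<in>UNIV. if i = k then (if i \<in> \<alpha> then x $ i else 0) else 0)" for i
    unfolding matrix_vector_mult_def vec_lambda_beta
    by (intro sum.cong refl) (auto simp: submat_def mat_def)
  then show ?thesis by (simp add: vec_eq_iff subvec_def)
qed

lemma submat_mult_vec_outside:
  assumes "submat W \<beta> \<alpha> = W" "k \<notin> \<beta>"
  shows "(W *v y) $ k = 0"
proof -
  have "W $ k $ i = 0" for i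
    using arg_cong[OF assms(1), of "\<lambda>M. M $ k $ i"] assms(2) by (simp add: submat_def)
  then show ?thesis by (simp add: matrix_vector_mult_def)
qed

lemma submat_inv_solves:
  assumes "is_submat_inv M \<alpha> \<beta> W" "i \<in> \<alpha>"
  shows "(M *v (W *v y)) $ i = y $ i"
proof -
  have W: "submat W \<beta> \<alpha> = W" "submat M \<alpha> \<beta> ** W = submat (mat 1) \<alpha> \<alpha>"
    using assms(1) by (auto simp: is_submat_inv_def)
  have "(M *v (W *v y)) $ i = (submat M \<alpha> \<beta> *v (W *v y)) $ i"
    using submat_mult_vec_nth[of \<beta> "W *v y" M \<alpha> i] submat_mult_vec_outside[OF W(1)] assms(2) by auto
  also have "\<dots> = y $ i"
    using assms(2) by (simp add: matrix_vector_mul_assoc W(2) submat_id_mult_vec subvec_def)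
  finally show ?thesis .
qed

lemma uniquely_solvable_if_submat_invertible:
  assumes "submat_invertible M \<alpha> \<beta>"
  shows "uniquely_solvable M \<alpha> \<beta>"
proof -
  obtain W where inv: "is_submat_inv M \<alpha> \<beta> W"
    using assms by (auto simp: submat_invertible_def)
  then have W: "submat W \<beta> \<alpha> = W" "W ** submat M \<alpha> \<beta> = submat (mat 1) \<beta> \<beta>"
    by (auto simp: is_submat_inv_def)
  have "x = 0" if x: "\<forall>k. k \<notin> \<beta> \<longrightarrow> x $ k = 0" "\<forall>i\<in>\<alpha>. (M *v x) $ i = 0" for x
  proof -
    have "submat M \<alpha> \<beta> *v x = 0"
      using submat_mult_vec_nth[of \<beta> x M \<alpha>] x by (auto simp: vec_eq_iff)
    then have "subvec x \<beta> = 0"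
      by (metis W(2) matrix_vector_mul_assoc matrix_vector_mult_0_right submat_id_mult_vec)
    then show "x = 0"
      using x(1) by (auto simp: vec_eq_iff subvec_def split: if_splits)
  qed
  moreover have "\<exists>x. (\<forall>k. k \<notin> \<beta> \<longrightarrow> x $ k = 0) \<and> (\<forall>i\<in>\<alpha>. (M *v x) $ i = y $ i)" for y
    using submat_inv_solves[OF inv] submat_mult_vec_outside[OF W(1)] by blast
  ultimately show ?thesis by (auto simp: uniquely_solvable_def)
qed

text \<open>Solutions for the unit vectors of \<open>\<alpha>\<close> are the columns of a right
  inverse \<open>W\<close>. With S the submatrix, S W S = S puts W S x -
  \<open>subvec x \<beta>\<close> into the kernel of S, so uniqueness makes \<open>W\<close> a left
  inverse as well.\<close>

lemma submat_invertible_if_uniquely_solvable: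
  fixes M :: "real^'n^'m"
  assumes "uniquely_solvable M \<alpha> \<beta>"
  shows "submat_invertible M \<alpha> \<beta>"
proof -
  let ?S = "submat M \<alpha> \<beta>"
  have "\<exists>f. \<forall>y. (\<forall>k. k \<notin> \<beta> \<longrightarrow> f y $ k = 0) \<and> (\<forall>i\<in>\<alpha>. (M *v f y) $ i = y $ i)"
    using assms unfolding uniquely_solvable_def by (intro choice) blast
  then obtain f where f: "\<And>y k. k \<notin> \<beta> \<Longrightarrow> f y $ k = 0"
      "\<And>y i. i \<in> \<alpha> \<Longrightarrow> (M *v f y) $ i = y $ i"
    by blast
  have uniq: "x = 0" if "\<And>k. k \<notin> \<beta> \<Longrightarrow> x $ k = 0" "\<And>i. i \<in> \<alpha> \<Longrightarrow> (M *v x) $ i = 0" for x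
    using assms that unfolding uniquely_solvable_def by blast
  \<comment> \<open>Columns outside \<open>\<alpha>\<close> are set to zero to meet the support
    condition of \<open>is_submat_inv\<close>.\<close>
  define W :: "real^'m^'n" where
    "W = (\<chi> k i. if i \<in> \<alpha> then f (axis i 1) $ k else 0)"
  have supp: "submat W \<beta> \<alpha> = W"
    by (auto simp: W_def submat_def vec_eq_iff f(1))
  have idem: "submat ?S \<alpha> \<beta> = ?S"
    by (simp add: submat_def vec_eq_iff)
  have right: "?S ** W = submat (mat 1) \<alpha> \<alpha>"
  proof -
    have "(?S ** W) $ i' $ i = submat (mat 1) \<alpha> \<alpha> $ i' $ i" for i' i
    proof (cases "i \<in> \<alpha>")
      case True
      have "(?S ** W) $ i' $ i = (?S *v f (axis i 1)) $ i'"
        using True by (simp add: matrix_matrix_mult_def matrix_vector_mult_def W_def)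
      also have "\<dots> = (if i' \<in> \<alpha> then axis i 1 $ i' else 0)"
        using submat_mult_vec_nth[of \<beta> "f (axis i 1)" M \<alpha> i'] f by auto
      also have "\<dots> = submat (mat 1) \<alpha> \<alpha> $ i' $ i"
        using True by (auto simp: submat_def mat_def axis_def)
      finally show ?thesis .
    qed (simp add: matrix_matrix_mult_def W_def submat_def)
    then show ?thesis by (simp add: vec_eq_iff)
  qed
  have "W ** ?S = submat (mat 1) \<beta> \<beta>"
  proof -
    have "(W ** ?S) *v x = submat (mat 1) \<beta> \<beta> *v x" for x
    proof -
      let ?e = "W *v (?S *v x) - subvec x \<beta>"
      have "?S *v subvec x \<beta> = ?S *v x"
        by (auto simp: matrix_vector_mult_def submat_def subvec_def intro!: sum.cong)
      moreover have "?S *v (W *v (?S *v x)) = ?S *v x"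
        by (simp add: matrix_vector_mul_assoc matrix_mul_assoc right submat_mult_id_left[OF idem])
      ultimately have S0: "?S *v ?e = 0"
        by (simp add: matrix_vector_mult_diff_distrib)
      have e0: "?e $ k = 0" if "k \<notin> \<beta>" for k
        using submat_mult_vec_outside[OF supp that] that by (simp add: subvec_def)
      have "(M *v ?e) $ i = 0" if "i \<in> \<alpha>" for i
        using submat_mult_vec_nth[of \<beta> ?e M \<alpha> i] e0 S0 that by simp
      then have "?e = 0" using e0 uniq by blast
      then show ?thesis
        by (simp add: matrix_vector_mul_assoc submat_id_mult_vec)
    qed
    then show ?thesis by (simp add: matrix_eq)
  qed
  with supp right show ?thesis
    unfolding submat_invertible_def is_submat_inv_def by blast
qed

text \<open>The kernel vector \<open>d\<close> expresses column \<open>j\<close> through the columns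
  in \<open>\<beta>\<close>, with a nonzero coefficient at \<open>x\<close>. Multiples of
  \<open>d\<close> therefore trade the coordinate \<open>x\<close> for the coordinate
  \<open>j\<close>.\<close>

lemma uniquely_solvable_exchange:
  assumes us: "uniquely_solvable M UNIV \<beta>"
    and d: "M *v d = 0" "\<And>k. k \<notin> insert j \<beta> \<Longrightarrow> d $ k = 0" "d $ j = 1" "d $ x \<noteq> 0"
    and j: "j \<notin> \<beta>" and x: "x \<in> \<beta>"
  shows "uniquely_solvable M UNIV (insert j (\<beta> - {x}))"
  unfolding uniquely_solvable_def
proof (intro conjI allI impI)
  fix y
  obtain w where w: "\<And>k. k \<notin> \<beta> \<Longrightarrow> w $ k = 0" "M *v w = y"
    using us unfolding uniquely_solvable_def by (metis UNIV_I vec_eq_iff)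
  \<comment> \<open>This multiple of \<open>d\<close> cancels the entry at \<open>x\<close>.\<close>
  let ?w = "w - (w $ x / d $ x) *\<^sub>R d"
  have "M *v ?w = y"
    by (simp add: matrix_vector_mult_diff_distrib matrix_vector_mult_scaleR w d)
  moreover have "?w $ k = 0" if "k \<notin> insert j (\<beta> - {x})" for k
    using that w d by (cases "k = x") auto
  ultimately show "\<exists>w. (\<forall>k. k \<notin> insert j (\<beta> - {x}) \<longrightarrow> w $ k = 0) \<and> (\<forall>i\<in>UNIV. (M *v w) $ i = y $ i)"
    by metis
next
  fix w assume w: "(\<forall>k. k \<notin> insert j (\<beta> - {x}) \<longrightarrow> w $ k = 0) \<and> (\<forall>i\<in>UNIV. (M *v w) $ i = 0)"
  then have Mw: "M *v w = 0" by (simp add: vec_eq_iff)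
  \<comment> \<open>Cancelling the entry at \<open>j\<close> leaves a kernel vector supported on
    \<open>\<beta>\<close>, hence zero. So \<open>w\<close> is a multiple of \<open>d\<close>, and
    its zero entry at \<open>x\<close> forces the factor to vanish.\<close>
  let ?e = "w - w $ j *\<^sub>R d"
  have "M *v ?e = 0"
    by (simp add: matrix_vector_mult_diff_distrib matrix_vector_mult_scaleR Mw d)
  moreover have "?e $ k = 0" if "k \<notin> \<beta>" for k
    using that w d by (cases "k = j") auto
  ultimately have "?e = 0"
    using us unfolding uniquely_solvable_def by (metis zero_index)
  moreover have "w $ x = 0" using w j x by auto
  ultimately have "w $ j * d $ x = 0"
    by (metis diff_0 neg_equal_0_iff_equal real_scaleR_def vector_minus_component vector_scaleR_component zero_index)
  then show "w = 0" using d \<open>?e = 0\<close> by simp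
qed

section \<open>Rates of structural variables and slacks\<close>

definition rate_vec :: "real^'n^'m \<Rightarrow> real^'n \<Rightarrow> real^('n + 'm)" where
  "rate_vec A d = (\<chi> x. var_rate A d x)"

lemma slack_form_mult_vec:
  "(slack_form A *v w) $ i = (A *v (\<chi> j. w $ Inl j)) $ i - w $ Inr i"
proof -
  have "(slack_form A *v w) $ i = (\<Sum>x\<in>UNIV <+> UNIV. slack_form A $ i $ x * w $ x)"
    by (simp add: matrix_vector_mult_def)
  also have "\<dots> = (\<Sum>j\<in>UNIV. A $ i $ j * w $ Inl j)
      + (\<Sum>i'\<in>UNIV. (if i' = i then -1 else 0) * w $ Inr i')"
    by (subst sum.Plus) (auto simp: slack_form_def)
  also have "(\<Sum>i'\<in>UNIV. (if i' = i then -1 else 0) * w $ Inr i') = (\<Sum>i'\<in>UNIV. if i' = i then - w $ Inr i else 0)"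
    by (intro sum.cong) auto
  finally show ?thesis by (simp add: matrix_vector_mult_def)
qed

lemma slack_form_rate_vec: "slack_form A *v rate_vec A d = 0"
  by (simp add: vec_eq_iff slack_form_mult_vec rate_vec_def)

lemma linear_var_rate: "linear (\<lambda>d. var_rate A d x)"
  by (cases x) (auto intro!: linearI simp: matrix_vector_right_distrib matrix_vector_mult_scaleR)

lemmas var_rate_scaleR = linear_scale[OF linear_var_rate]
  and var_rate_diff = linear_diff[OF linear_var_rate]
  and var_rate_sum = linear_sum[OF linear_var_rate]

lemma var_value_add: "var_value A b (z + d) x = var_value A b z x + var_rate A d x"
  by (cases x) (auto simp: matrix_vector_right_distrib)

lemma var_rate_diff_points: "var_rate A (z1 - z2) x = var_value A b z1 x - var_value A b z2 x"
  using var_value_add[of A b z2 "z1 - z2" x] by simp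

lemma var_value_convex:
  "var_value A b (t *\<^sub>R z1 + (1 - t) *\<^sub>R z2) x = t * var_value A b z1 x + (1 - t) * var_value A b z2 x"
  by (cases x)
    (auto simp: matrix_vector_right_distrib matrix_vector_mult_scaleR algebra_simps)

text \<open>The rates form a kernel vector of the slack form, so a direction is determined by its
  nonbasic rates. Directions are compared below in this way.\<close>

lemma zero_if_nonbasic_rates_zero:
  assumes "uniquely_solvable (slack_form A) UNIV (basic_vars I)"
    and "\<And>x. x \<notin> basic_vars I \<Longrightarrow> var_rate A d x = 0"
  shows "d = 0"
proof -
  have "rate_vec A d = 0"
    using assms slack_form_rate_vec[of A d] unfolding uniquely_solvable_def
    by (metis rate_vec_def vec_lambda_beta zero_index)
  then have "var_rate A d (Inl j) = 0" for j
    by (metis rate_vec_def vec_lambda_beta zero_index)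
  then show ?thesis by (simp add: vec_eq_iff)
qed

text \<open>Basic slack columns vanish in the active rows, so the basis matrix is block triangular:
  the structural part of a full solution already solves the active rows.\<close>

lemma submat_invertible_active_basic:
  assumes us: "uniquely_solvable (slack_form A) UNIV (basic_vars I)" and "index_partition I"
  shows "submat_invertible A (active I) (basic I)"
proof (rule submat_invertible_if_uniquely_solvable, unfold uniquely_solvable_def,
    intro conjI allI impI)
  have part: "i \<in> active I \<longleftrightarrow> i \<notin> inactive I" for i
    using assms(2) by (auto simp: index_partition_def)
  fix y
  obtain w where w: "\<And>x. x \<notin> basic_vars I \<Longrightarrow> w $ x = 0" "slack_form A *v w = y"
    using us unfolding uniquely_solvable_def by (metis UNIV_I vec_eq_iff)
  have "(A *v (\<chi> j. w $ Inl j)) $ i = y $ i" if "i \<in> active I" for i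
    using slack_form_mult_vec[of A w i] w that part by (auto simp: basic_vars_def)
  moreover have "(\<chi> j. w $ Inl j) $ k = 0" if "k \<notin> basic I" for k
    using w that by (auto simp: basic_vars_def)
  ultimately show "\<exists>x. (\<forall>k. k \<notin> basic I \<longrightarrow> x $ k = 0) \<and> (\<forall>i\<in>active I. (A *v x) $ i = y $ i)"
    by blast
next
  fix d assume d: "(\<forall>k. k \<notin> basic I \<longrightarrow> d $ k = 0) \<and> (\<forall>i\<in>active I. (A *v d) $ i = 0)"
  have "var_rate A d x = 0" if "x \<notin> basic_vars I" for x
    using that d assms(2) by (cases x) (auto simp: basic_vars_def index_partition_def)
  then show "d = 0" using zero_if_nonbasic_rates_zero[OF us] by blast
qed

text \<open>Each cone condition is a pair of bounds, 0 or infinite, on a slack, so rows and variable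
  bounds can be handled together.\<close>

lemma feasible_set_iff:
  "z \<in> feasible_set A b \<kappa> l u \<longleftrightarrow>
    (\<forall>x. var_lower \<kappa> l x \<le> ereal (var_value A b z x) \<and> ereal (var_value A b z x) \<le> var_upper \<kappa> u x)"
proof -
  have "(A *v z - b) $ i \<in> sense_cone (\<kappa> i) \<longleftrightarrow>
    var_lower \<kappa> l (Inr i) \<le> ereal (var_value A b z (Inr i)) \<and>
    ereal (var_value A b z (Inr i)) \<le> var_upper \<kappa> u (Inr i)" for i
    by (cases "\<kappa> i") (auto simp: zero_ereal_def)
  then show ?thesis
    by (auto simp: feasible_set_def product_cone_def split_sum_all)
qed

section \<open>Free directions\<close>

text \<open>The basic entries are chosen to cancel the contribution of column \<open>j\<close> on
  every active row, so among the nonbasic variables only \<open>Inl j\<close> moves.\<close>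

lemma free_direction_rate:
  assumes us: "uniquely_solvable (slack_form A) UNIV (basic_vars I)" and part: "index_partition I"
    and j: "j \<in> nb_free I" and x: "x \<notin> basic_vars I"
  shows "var_rate A (free_direction A I j) x = (if x = Inl j then 1 else 0)"
proof (cases x)
  case (Inl k)
  then show ?thesis
    using x j part by (auto simp: free_direction_def basic_vars_def index_partition_def)
next
  case (Inr i)
  then have i: "i \<in> active I"
    using x part by (auto simp: basic_vars_def index_partition_def)
  let ?W = "submat_inv A (active I) (basic I)" and ?c = "subvec (column j A) (active I)"
  have W: "is_submat_inv A (active I) (basic I) ?W"
    using submat_invertible_active_basic[OF us part] submat_inv_eqI
    unfolding submat_invertible_def by metis
  then have "submat ?W (basic I) (active I) = ?W" by (simp add: is_submat_inv_def)
  \<comment> \<open>The correction is supported on \<open>basic I\<close>, where the unit vector is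
    zero because \<open>j\<close> is nonbasic.\<close>
  then have "free_direction A I j = axis j 1 - ?W *v ?c"
    using submat_mult_vec_outside[of ?W "basic I" "active I"] j part
    by (auto simp: free_direction_def vec_eq_iff axis_def index_partition_def)
  then have "(A *v free_direction A I j) $ i = column j A $ i - ?c $ i"
    using submat_inv_solves[OF W i]
    by (simp add: matrix_vector_mult_diff_distrib matrix_vector_mult_basis)
  then show ?thesis using i Inr by (simp add: subvec_def)
qed

text \<open>Both sides have the same nonbasic rates: \<open>d $ k\<close> at \<open>Inl k\<close>
  for \<open>k\<close> in \<open>nb_free I\<close>, and zero at all other nonbasic
  variables.\<close>

lemma free_direction_decomposition:
  assumes us: "uniquely_solvable (slack_form A) UNIV (basic_vars I)" and part: "index_partition I"
    and d: "\<And>x. x \<notin> basic_vars I \<Longrightarrow> x \<notin> Inl ` nb_free I \<Longrightarrow> var_rate A d x = 0"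
  shows "d = (\<Sum>j\<in>nb_free I. d $ j *\<^sub>R free_direction A I j)"
proof -
  let ?s = "\<Sum>j\<in>nb_free I. d $ j *\<^sub>R free_direction A I j"
  have "var_rate A (d - ?s) x = 0" if x: "x \<notin> basic_vars I" for x
  proof -
    have "var_rate A ?s x = (\<Sum>j\<in>nb_free I. d $ j * (if x = Inl j then 1 else 0))"
      by (simp add: var_rate_sum var_rate_scaleR free_direction_rate[OF us part _ x])
    also have "\<dots> = var_rate A d x"
    proof (cases "x \<in> Inl ` nb_free I")
      case True
      then obtain k where "k \<in> nb_free I" "x = Inl k" by auto
      then show ?thesis by (simp add: if_distrib[of "\<lambda>c. _ * c"] cong: if_cong)
    next
      case False
      then have "(\<Sum>j\<in>nb_free I. d $ j * (if x = Inl j then 1 else 0)) = 0"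
        by (intro sum.neutral) auto
      then show ?thesis using d[OF x False] by simp
    qed
    finally show ?thesis by (simp add: var_rate_diff)
  qed
  then have "d - ?s = 0" using zero_if_nonbasic_rates_zero[OF us] by blast
  then show ?thesis by simp
qed

lemma free_direction_nb_free:
  assumes "index_partition I" "j \<in> nb_free I" "k \<in> nb_free I"
  shows "free_direction A I j $ k = (if k = j then 1 else 0)"
  using assms by (auto simp: free_direction_def index_partition_def)

lemma inj_on_free_direction:
  assumes "index_partition I"
  shows "inj_on (free_direction A I) (nb_free I)"
  by (rule inj_onI) (metis assms free_direction_nb_free zero_neq_one)

text \<open>On the coordinates in \<open>nb_free I\<close> the free directions are unit vectors, so
  each such coordinate of a combination reads off one coefficient.\<close>

lemma independent_free_directions:
  assumes "index_partition I"
  shows "independent (free_direction A I ` nb_free I)"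
proof (rule independent_if_scalars_zero)
  fix f v assume sum0: "(\<Sum>w\<in>free_direction A I ` nb_free I. f w *\<^sub>R w) = 0"
    and "v \<in> free_direction A I ` nb_free I"
  then obtain k where k: "k \<in> nb_free I" "v = free_direction A I k" by blast
  have "0 = (\<Sum>j\<in>nb_free I. f (free_direction A I j) *\<^sub>R free_direction A I j) $ k"
    using sum0 by (simp add: sum.reindex[OF inj_on_free_direction[OF assms]])
  also have "\<dots> = (\<Sum>j\<in>nb_free I. if k = j then f v else 0)"
    unfolding sum_component vector_scaleR_component
    by (intro sum.cong) (auto simp: k free_direction_nb_free[OF assms])
  finally show "f v = 0" using k by simp
qed simp

section \<open>The ratio test\<close>

lemma bound_ratio_nonneg:
  assumes "lo \<le> ereal w" "ereal w \<le> hi"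
  shows "0 \<le> bound_ratio lo hi w r"
  using assms unfolding bound_ratio_def
  by (cases lo; cases hi) (auto simp: divide_nonneg_pos divide_nonneg_neg)

lemma bound_ratio_step:
  assumes "lo \<le> ereal w" "ereal w \<le> hi" "0 \<le> \<theta>" "ereal \<theta> \<le> bound_ratio lo hi w r"
  shows "lo \<le> ereal (w + \<theta> * r) \<and> ereal (w + \<theta> * r) \<le> hi"
proof -
  consider "r > 0" | "r < 0" | "r = 0" by linarith
  then show ?thesis
  proof cases
    case 1
    have "0 \<le> \<theta> * r" using 1 assms(3) by simp
    then have "ereal w \<le> ereal (w + \<theta> * r)" by simp
    then have "lo \<le> ereal (w + \<theta> * r)" using assms(1) order_trans by blast
    moreover have "ereal (w + \<theta> * r) \<le> hi"
      using assms 1 unfolding bound_ratio_def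
      by (cases hi) (auto simp: pos_le_divide_eq)
    ultimately show ?thesis ..
  next
    case 2
    have "\<theta> * r \<le> 0" using 2 assms(3) by (simp add: mult_nonneg_nonpos)
    then have "ereal (w + \<theta> * r) \<le> ereal w" by simp
    then have "ereal (w + \<theta> * r) \<le> hi" using assms(2) order_trans by blast
    moreover have "lo \<le> ereal (w + \<theta> * r)"
    proof (cases lo)
      case (real c)
      then have "\<theta> \<le> (w - c) / (- r)" using assms(4) 2 by (simp add: bound_ratio_def)
      then have "\<theta> * (- r) \<le> w - c" using 2 by (subst (asm) pos_le_divide_eq) auto
      then show ?thesis using real by simp
    qed (use assms in auto)
    ultimately show ?thesis by blast
  next
    case 3
    then show ?thesis using assms by simp
  qed
qed

text \<open>A finite ratio excludes a zero rate and an infinite bound ahead of the moving variable;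
  clearing the denominator then gives equality with that bound.\<close>

lemma bound_ratio_attained:
  assumes "lo \<le> ereal w" "ereal w \<le> hi" "bound_ratio lo hi w r = ereal \<theta>"
  shows "r \<noteq> 0 \<and> ereal (w + \<theta> * r) \<in> {lo, hi}"
proof -
  consider "r > 0" | "r < 0" | "r = 0" by linarith
  then show ?thesis
  proof cases
    case 1
    then show ?thesis using assms unfolding bound_ratio_def
      by (cases hi) (auto simp: field_simps)
  next
    case 2
    then show ?thesis using assms unfolding bound_ratio_def
      by (cases lo) (auto simp: field_simps)
  next
    case 3
    then show ?thesis using assms by (simp add: bound_ratio_def)
  qed
qed

text \<open>The bounds enclose a real value, so a variable that is not free has a real bound; the
  sign makes the variable move towards it.\<close>

lemma bound_ratio_finite_direction:
  assumes "\<not> (lo = -\<infinity> \<and> hi = \<infinity>)" "lo \<le> ereal w" "ereal w \<le> hi" "r \<noteq> 0"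
  obtains \<sigma> :: real where "\<sigma> \<in> {-1, 1}" "bound_ratio lo hi w (\<sigma> * r) < \<infinity>"
proof -
  have "bound_ratio lo hi w (- 1 * r) < \<infinity> \<or> bound_ratio lo hi w (1 * r) < \<infinity>"
    using assms unfolding bound_ratio_def by (cases lo; cases hi) auto
  then show ?thesis using that by blast
qed

section \<open>The pivoting invariant\<close>

text \<open>The bound condition covers structural variables and slacks alike and leaves open which
  bound is attained. The basis enters through unique solvability, the form that
  \<open>uniquely_solvable_exchange\<close> preserves.\<close>

definition pivot_invariant ::
  "real^'n^'m \<Rightarrow> real^'m \<Rightarrow> ('m \<Rightarrow> row_sense) \<Rightarrow> ('n \<Rightarrow> ereal) \<Rightarrow> ('n \<Rightarrow> ereal) \<Rightarrow>
   real^'n \<Rightarrow> ('n, 'm) index_sets \<Rightarrow> bool" where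
  "pivot_invariant A b \<kappa> l u z I \<longleftrightarrow>
     index_partition I \<and>
     uniquely_solvable (slack_form A) UNIV (basic_vars I) \<and>
     (\<forall>j\<in>nb_free I. l j = -\<infinity> \<and> u j = \<infinity>) \<and>
     (\<forall>x. x \<notin> basic_vars I \<longrightarrow> x \<notin> Inl ` nb_free I \<longrightarrow>
        ereal (var_value A b z x) \<in> {var_lower \<kappa> l x, var_upper \<kappa> u x}) \<and>
     z \<in> feasible_set A b \<kappa> l u"

lemma pivot_invariant_basic_feasible_solution:
  assumes bfs: "basic_feasible_solution A b \<kappa> l u z I"
  shows "pivot_invariant A b \<kappa> l u z I"
proof -
  have "ereal (var_value A b z x) \<in> {var_lower \<kappa> l x, var_upper \<kappa> u x}"
    if x: "x \<notin> basic_vars I" "x \<notin> Inl ` nb_free I" for x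
  proof (cases x)
    case (Inl k)
    then have "k \<in> nb_lower I \<union> nb_upper I"
      using x bfs by (auto simp: basic_feasible_solution_def index_partition_def basic_vars_def)
    then show ?thesis
      using bfs Inl by (auto simp: basic_feasible_solution_def)
  next
    \<comment> \<open>The slack of an active row is 0, and 0 is one of its bounds for each row
      sense.\<close>
    case (Inr i)
    then have "i \<in> active I"
      using x bfs by (auto simp: basic_feasible_solution_def index_partition_def basic_vars_def)
    then show ?thesis
      using bfs Inr by (cases "\<kappa> i") (auto simp: basic_feasible_solution_def zero_ereal_def)
  qed
  then show ?thesis
    using bfs uniquely_solvable_if_submat_invertible
    unfolding pivot_invariant_def basic_feasible_solution_def basis_matrix_invertible_def by blast
qed

text \<open>A nonzero rate puts a leaving structural variable into exactly one of
  \<open>nb_lower\<close> and \<open>nb_upper\<close>.\<close>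

lemma index_partition_exchange:
  assumes "index_partition I" "j \<in> nb_free I" "x \<in> basic_vars I" "r \<noteq> 0"
  shows "index_partition (exchange I j x r)"
  using assms by (cases x) (auto simp: index_partition_def basic_vars_def)

text \<open>In the joint indexing, a leaving structural variable and a leaving slack give the same
  one-element exchange.\<close>

lemma basic_vars_exchange:
  assumes "index_partition I" "j \<in> nb_free I" "x \<in> basic_vars I"
  shows "basic_vars (exchange I j x r) = insert (Inl j) (basic_vars I - {x})"
  using assms by (cases x) (auto simp: index_partition_def basic_vars_def)

lemma nb_free_exchange: "nb_free (exchange I j x r) = nb_free I - {j}"
  by (cases x) auto

text \<open>The step length is the smallest ratio: no basic variable passes a bound, the blocking
  variable reaches one, and the nonbasic variables other than \<open>Inl j\<close> stay fixed. The
  blocking rate is nonzero, as the basis exchange requires.\<close>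

lemma pivot_invariant_step:
  assumes inv: "pivot_invariant A b \<kappa> l u z I"
    and step: "pivot_step A b \<kappa> l u (z, I) (z', I')"
  shows "pivot_invariant A b \<kappa> l u z' I'"
  using step
proof cases
  case (pivot j \<sigma> d \<theta> x)
  note j = \<open>j \<in> nb_free I\<close>
  have part: "index_partition I" and us: "uniquely_solvable (slack_form A) UNIV (basic_vars I)"
    and free: "\<And>j. j \<in> nb_free I \<Longrightarrow> l j = -\<infinity> \<and> u j = \<infinity>"
    and at_bound: "\<And>x. x \<notin> basic_vars I \<Longrightarrow> x \<notin> Inl ` nb_free I \<Longrightarrow>
        ereal (var_value A b z x) \<in> {var_lower \<kappa> l x, var_upper \<kappa> u x}"
    and feas: "z \<in> feasible_set A b \<kappa> l u"
    using inv by (auto simp: pivot_invariant_def)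
  have bounds: "var_lower \<kappa> l x \<le> ereal (var_value A b z x)"
    "ereal (var_value A b z x) \<le> var_upper \<kappa> u x" for x
    using feas by (auto simp: feasible_set_iff)
  have value': "var_value A b z' y = var_value A b z y + \<theta> * var_rate A d y" for y
    using pivot by (simp add: var_value_add var_rate_scaleR)
  have xb: "x \<in> basic_vars I" using pivot by (simp add: nonfree_basic_vars_def)
  have jb: "Inl j \<notin> basic_vars I"
    using j part by (auto simp: basic_vars_def index_partition_def)
  have blocked: "var_rate A d x \<noteq> 0"
      "ereal (var_value A b z' x) \<in> {var_lower \<kappa> l x, var_upper \<kappa> u x}"
    using bound_ratio_attained[OF bounds] pivot value'[of x] by (auto simp: var_ratio_def)
  have \<theta>: "0 \<le> \<theta>"
    using bound_ratio_nonneg[OF bounds[of x], of "var_rate A d x"] pivot by (simp add: var_ratio_def)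
  have rate0: "var_rate A d y = 0" if "y \<notin> basic_vars I" "y \<noteq> Inl j" for y
    using that free_direction_rate[OF us part j] pivot by (simp add: var_rate_scaleR)
  have I': "I' = exchange I j x (var_rate A d x)" using pivot by simp
  have feas': "z' \<in> feasible_set A b \<kappa> l u"
    unfolding feasible_set_iff
  proof
    fix y
    show "var_lower \<kappa> l y \<le> ereal (var_value A b z' y) \<and> ereal (var_value A b z' y) \<le> var_upper \<kappa> u y"
    proof (cases "y \<in> nonfree_basic_vars \<kappa> l u I")
      case True
      then have "ereal \<theta> \<le> var_ratio A b \<kappa> l u z d y"
        using pivot by (metis INF_lower ratio_test_def)
      then show ?thesis
        using bound_ratio_step[OF bounds \<theta>] by (simp add: var_ratio_def value')
    next
      \<comment> \<open>Outside the ratio test there are only variables without bounds, among them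
        \<open>Inl j\<close>, and nonbasic variables with rate zero.\<close>
      case False
      then consider "var_lower \<kappa> l y = -\<infinity>" "var_upper \<kappa> u y = \<infinity>" | "y \<notin> basic_vars I" "y \<noteq> Inl j"
        using free[OF j] by (cases "y = Inl j") (auto simp: nonfree_basic_vars_def)
      then show ?thesis
        by cases (use rate0 bounds in \<open>auto simp: value'\<close>)
    qed
  qed
  \<comment> \<open>The exchange asks for rate 1 at \<open>Inl j\<close>, so the direction is taken
    without the sign \<open>\<sigma>\<close>.\<close>
  have us': "uniquely_solvable (slack_form A) UNIV (basic_vars I')"
    unfolding I' basic_vars_exchange[OF part j xb]
  proof (rule uniquely_solvable_exchange[OF us slack_form_rate_vec])
    show "rate_vec A (free_direction A I j) $ k = 0" if "k \<notin> insert (Inl j) (basic_vars I)" for k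
      using free_direction_rate[OF us part j] that by (auto simp: rate_vec_def)
    show "rate_vec A (free_direction A I j) $ Inl j = 1"
      using free_direction_rate[OF us part j jb] by (simp add: rate_vec_def)
    show "rate_vec A (free_direction A I j) $ x \<noteq> 0"
      using blocked pivot by (auto simp: rate_vec_def var_rate_scaleR)
  qed (use jb xb in auto)
  have "ereal (var_value A b z' y) \<in> {var_lower \<kappa> l y, var_upper \<kappa> u y}"
    if "y \<notin> basic_vars I'" "y \<notin> Inl ` nb_free I'" for y
  proof (cases "y = x")
    case False
    then have "y \<notin> basic_vars I" "y \<noteq> Inl j" "y \<notin> Inl ` nb_free I"
      using that unfolding I' basic_vars_exchange[OF part j xb] nb_free_exchange by auto
    then show ?thesis using at_bound rate0 by (simp add: value')
  qed (use blocked in simp)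
  then show ?thesis
    using index_partition_exchange[OF part j xb blocked(1)] us' feas' free
    unfolding pivot_invariant_def by (auto simp: I' nb_free_exchange)
qed

lemma pivot_invariant_steps:
  assumes "(pivot_step A b \<kappa> l u)\<^sup>*\<^sup>* s s'" "pivot_invariant A b \<kappa> l u (fst s) (snd s)"
  shows "pivot_invariant A b \<kappa> l u (fst s') (snd s')"
  using assms by induction (auto intro: pivot_invariant_step simp: prod.collapse)

lemma terminal_rate_zero:
  assumes inv: "pivot_invariant A b \<kappa> l u z I"
    and terminal: "\<nexists>s. pivot_step A b \<kappa> l u (z, I) s"
    and j: "j \<in> nb_free I" and x: "x \<in> nonfree_basic_vars \<kappa> l u I"
  shows "var_rate A (free_direction A I j) x = 0"
proof (rule ccontr)
  assume "var_rate A (free_direction A I j) x \<noteq> 0"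
  have bounds: "var_lower \<kappa> l x \<le> ereal (var_value A b z x)"
    "ereal (var_value A b z x) \<le> var_upper \<kappa> u x" for x
    using inv by (auto simp: feasible_set_iff pivot_invariant_def)
  obtain \<sigma> :: real where \<sigma>: "\<sigma> \<in> {-1, 1}"
    "var_ratio A b \<kappa> l u z (\<sigma> *\<^sub>R free_direction A I j) x < \<infinity>"
    using bound_ratio_finite_direction[OF _ bounds \<open>var_rate A (free_direction A I j) x \<noteq> 0\<close>] x
    unfolding var_ratio_def nonfree_basic_vars_def var_rate_scaleR real_scaleR_def by blast
  define d where "d = \<sigma> *\<^sub>R free_direction A I j"
  let ?R = "var_ratio A b \<kappa> l u z d ` nonfree_basic_vars \<kappa> l u I"
  \<comment> \<open>The infimum over a finite nonempty set is attained. This supplies the blocking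
    variable \<open>y\<close>, which may differ from \<open>x\<close>.\<close>
  have "finite ?R" "?R \<noteq> {}" using x by auto
  then have "ratio_test A b \<kappa> l u I z d \<in> ?R"
    unfolding ratio_test_def by (metis Min_Inf Min_in)
  then obtain y where y: "y \<in> nonfree_basic_vars \<kappa> l u I"
    "ratio_test A b \<kappa> l u I z d = var_ratio A b \<kappa> l u z d y" by blast
  have "ratio_test A b \<kappa> l u I z d < \<infinity>"
    using \<sigma>(2) INF_lower[OF x] unfolding ratio_test_def d_def by (metis le_less_trans)
  \<comment> \<open>Nonnegativity excludes the value \<open>-\<infinity>\<close>, so the ratio is a
    real number, as the pivot rule demands.\<close>
  moreover have "0 \<le> ratio_test A b \<kappa> l u I z d"
    unfolding y(2) var_ratio_def by (rule bound_ratio_nonneg[OF bounds])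
  ultimately obtain \<theta> where \<theta>: "ratio_test A b \<kappa> l u I z d = ereal \<theta>"
    by (cases "ratio_test A b \<kappa> l u I z d") auto
  then show False
    using terminal pivot_step.pivot[OF j \<sigma>(1) d_def \<theta> y(1) trans[OF y(2)[symmetric] \<theta>]] by blast
qed

section \<open>The lineality space\<close>

lemma zero_if_line_bounded:
  fixes r w c :: real
  assumes "(\<forall>t. w + t * r \<le> c) \<or> (\<forall>t. c \<le> w + t * r)"
  shows "r = 0"
proof (rule ccontr)
  assume "r \<noteq> 0"
  \<comment> \<open>For nonzero \<open>r\<close> the affine function takes every value;
    \<open>s = 1\<close> and \<open>s = -1\<close> overshoot an upper and a lower bound.\<close>
  then have line: "w + ((c - w + s) / r) * r = c + s" for s by simp
  from assms show False
  proof
    assume "\<forall>t. w + t * r \<le> c"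
    then have "w + ((c - w + 1) / r) * r \<le> c" by blast
    then show False by (simp only: line)
  next
    assume "\<forall>t. c \<le> w + t * r"
    then have "c \<le> w + ((c - w + (- 1)) / r) * r" by blast
    then show False by (simp only: line)
  qed
qed

text \<open>A lineality direction yields a whole line through \<open>z\<close> in the set, and a
  variable with a bound is constant along it. The point \<open>z\<close> matters: the recession cone
  of the empty set is the whole space.\<close>

lemma lineality_space_feasible_set:
  assumes z: "z \<in> feasible_set A b \<kappa> l u"
  shows "lineality_space (feasible_set A b \<kappa> l u) =
    {d. \<forall>x. \<not> (var_lower \<kappa> l x = -\<infinity> \<and> var_upper \<kappa> u x = \<infinity>) \<longrightarrow> var_rate A d x = 0}"
    (is "lineality_space ?C = ?L")
proof
  show "lineality_space ?C \<subseteq> ?L"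
  proof
    fix d assume d: "d \<in> lineality_space ?C"
    have line: "z + t *\<^sub>R d \<in> ?C" for t
    proof (cases "t \<ge> 0")
      case False
      have "- d \<in> recession_cone ?C" using d by (auto simp: lineality_space_def)
      then have "z + (- t) *\<^sub>R (- d) \<in> ?C"
        using False z unfolding recession_cone_def by (simp only: mem_Collect_eq)
      then show ?thesis by simp
    qed (use d z in \<open>auto simp: lineality_space_def recession_cone_def\<close>)
    have "var_rate A d x = 0" if nonfree: "\<not> (var_lower \<kappa> l x = -\<infinity> \<and> var_upper \<kappa> u x = \<infinity>)" for x
    proof -
      have *: "var_lower \<kappa> l x \<le> ereal (var_value A b z x + t * var_rate A d x)"
        "ereal (var_value A b z x + t * var_rate A d x) \<le> var_upper \<kappa> u x" for t
        using line[of t] by (auto simp: feasible_set_iff var_value_add var_rate_scaleR)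
      show ?thesis
      proof (cases "var_lower \<kappa> l x = -\<infinity>")
        case True
        then obtain c where "var_upper \<kappa> u x = ereal c"
          using nonfree *(2)[of 0] by (cases "var_upper \<kappa> u x") auto
        then have "\<forall>t. var_value A b z x + t * var_rate A d x \<le> c"
          using *(2) by simp
        then show ?thesis using zero_if_line_bounded by blast
      next
        case False
        then obtain c where "var_lower \<kappa> l x = ereal c"
          using *(1)[of 0] by (cases "var_lower \<kappa> l x") auto
        then have "\<forall>t. c \<le> var_value A b z x + t * var_rate A d x"
          using *(1) by simp
        then show ?thesis using zero_if_line_bounded by blast
      qed
    qed
    then show "d \<in> ?L" by blast
  qed
next
  have rec: "d \<in> recession_cone ?C" if d: "d \<in> ?L" for d
    unfolding recession_cone_def
  proof (intro CollectI ballI allI impI)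
    fix y and t :: real assume y: "y \<in> ?C" "0 \<le> t"
    show "y + t *\<^sub>R d \<in> ?C"
      unfolding feasible_set_iff
    proof
      fix x
      show "var_lower \<kappa> l x \<le> ereal (var_value A b (y + t *\<^sub>R d) x) \<and>
          ereal (var_value A b (y + t *\<^sub>R d) x) \<le> var_upper \<kappa> u x"
      proof (cases "var_lower \<kappa> l x = -\<infinity> \<and> var_upper \<kappa> u x = \<infinity>")
        case False
        then have "var_rate A d x = 0" using d by blast
        then show ?thesis using y(1)
          by (simp add: feasible_set_iff var_value_add var_rate_scaleR)
      qed auto
    qed
  qed
  show "?L \<subseteq> lineality_space ?C"
  proof
    fix d assume "d \<in> ?L"
    \<comment> \<open>The right-hand side is closed under negation, so \<open>rec\<close> yields
      both halves of the lineality space.\<close>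
    moreover from this have "- d \<in> ?L" by (auto simp: linear_neg[OF linear_var_rate])
    ultimately show "d \<in> lineality_space ?C"
      using rec[of d] rec[of "- d"] image_eqI[of d uminus "- d"]
      by (simp add: lineality_space_def)
  qed
qed

text \<open>For a free direction, termination settles the basic variables with a bound, and the only
  nonbasic variable that moves is itself free. The converse inclusion is the decomposition
  lemma.\<close>

lemma span_free_directions_eq_lineality_space:
  assumes inv: "pivot_invariant A b \<kappa> l u z I"
    and terminal: "\<nexists>s. pivot_step A b \<kappa> l u (z, I) s"
  shows "span (free_direction A I ` nb_free I) = lineality_space (feasible_set A b \<kappa> l u)"
proof -
  have part: "index_partition I" and us: "uniquely_solvable (slack_form A) UNIV (basic_vars I)"
    and free: "\<And>j. j \<in> nb_free I \<Longrightarrow> l j = -\<infinity> \<and> u j = \<infinity>"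
    and at_bound: "\<And>x. x \<notin> basic_vars I \<Longrightarrow> x \<notin> Inl ` nb_free I \<Longrightarrow>
        ereal (var_value A b z x) \<in> {var_lower \<kappa> l x, var_upper \<kappa> u x}"
    and feas: "z \<in> feasible_set A b \<kappa> l u"
    using inv by (auto simp: pivot_invariant_def)
  let ?L = "{d. \<forall>x. \<not> (var_lower \<kappa> l x = -\<infinity> \<and> var_upper \<kappa> u x = \<infinity>) \<longrightarrow> var_rate A d x = 0}"
  have "span (free_direction A I ` nb_free I) \<subseteq> ?L"
  proof (rule span_minimal)
    show "subspace ?L"
      by (auto simp: subspace_def linear_0[OF linear_var_rate] linear_add[OF linear_var_rate]
          var_rate_scaleR)
    have "var_rate A (free_direction A I j) x = 0"
      if j: "j \<in> nb_free I" and x: "\<not> (var_lower \<kappa> l x = -\<infinity> \<and> var_upper \<kappa> u x = \<infinity>)" for j x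
    proof (cases "x \<in> basic_vars I")
      case True
      then show ?thesis using terminal_rate_zero[OF inv terminal j] x
        by (simp add: nonfree_basic_vars_def)
    next
      case False
      then show ?thesis using free_direction_rate[OF us part j] x free[OF j] by auto
    qed
    then show "free_direction A I ` nb_free I \<subseteq> ?L" by blast
  qed
  moreover have "?L \<subseteq> span (free_direction A I ` nb_free I)"
  proof
    fix d assume d: "d \<in> ?L"
    \<comment> \<open>The real value of \<open>x\<close> equals one of its bounds, so
      \<open>x\<close> is not free and membership in \<open>?L\<close> applies.\<close>
    have "var_rate A d x = 0" if "x \<notin> basic_vars I" "x \<notin> Inl ` nb_free I" for x
      using d at_bound[OF that] by force
    then have "d = (\<Sum>j\<in>nb_free I. d $ j *\<^sub>R free_direction A I j)"
      by (rule free_direction_decomposition[OF us part])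
    then show "d \<in> span (free_direction A I ` nb_free I)"
      by (metis (no_types, lifting) imageI span_base span_scale span_sum)
  qed
  ultimately show ?thesis using lineality_space_feasible_set[OF feas] by blast
qed

section \<open>Convex combinations and implicit extremality\<close>

lemma convex_combination_at_bound:
  fixes t w1 w2 :: real
  assumes t: "0 < t" "t < 1"
    and bounds: "lo \<le> ereal w1" "ereal w1 \<le> hi" "lo \<le> ereal w2" "ereal w2 \<le> hi"
    and at_bound: "ereal (t * w1 + (1 - t) * w2) \<in> {lo, hi}"
  shows "w1 = w2"
proof -
  \<comment> \<open>The displacements from \<open>w1\<close> and \<open>w2\<close> are positive
    multiples of \<open>w2 - w1\<close> and \<open>w1 - w2\<close>. At an end of the interval they
    cannot have strictly opposite signs.\<close>
  have "t * w1 + (1 - t) * w2 = w1 + (1 - t) * (w2 - w1)"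
    and "t * w1 + (1 - t) * w2 = w2 + t * (w1 - w2)" by (auto simp: algebra_simps)
  moreover have "(t * w1 + (1 - t) * w2 \<le> w1 \<and> t * w1 + (1 - t) * w2 \<le> w2)
      \<or> (w1 \<le> t * w1 + (1 - t) * w2 \<and> w2 \<le> t * w1 + (1 - t) * w2)"
    using bounds at_bound by auto
  ultimately have "((1 - t) * (w2 - w1) \<le> 0 \<and> t * (w1 - w2) \<le> 0)
      \<or> (0 \<le> (1 - t) * (w2 - w1) \<and> 0 \<le> t * (w1 - w2))" by linarith
  then show ?thesis using t by (auto simp: mult_le_0_iff zero_le_mult_iff)
qed

lemma implicit_extreme_point_terminal:
  assumes inv: "pivot_invariant A b \<kappa> l u z I"
    and terminal: "\<nexists>s. pivot_step A b \<kappa> l u (z, I) s"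
  shows "implicit_extreme_point z (feasible_set A b \<kappa> l u)"
  unfolding implicit_extreme_point_def
proof (intro conjI ballI allI impI)
  let ?C = "feasible_set A b \<kappa> l u"
  have part: "index_partition I" and us: "uniquely_solvable (slack_form A) UNIV (basic_vars I)"
    and at_bound: "\<And>x. x \<notin> basic_vars I \<Longrightarrow> x \<notin> Inl ` nb_free I \<Longrightarrow>
        ereal (var_value A b z x) \<in> {var_lower \<kappa> l x, var_upper \<kappa> u x}"
    using inv by (auto simp: pivot_invariant_def)
  show "z \<in> ?C" using inv by (simp add: pivot_invariant_def)
  fix z1 z2 t assume z12: "z1 \<in> ?C" "z2 \<in> ?C"
    and t: "0 < t \<and> t < 1 \<and> z = t *\<^sub>R z1 + (1 - t) *\<^sub>R z2"
  have "var_rate A (z1 - z2) x = 0" if "x \<notin> basic_vars I" "x \<notin> Inl ` nb_free I" for x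
  proof -
    have "var_value A b z1 x = var_value A b z2 x"
      using convex_combination_at_bound[of t "var_lower \<kappa> l x" "var_value A b z1 x"
          "var_upper \<kappa> u x" "var_value A b z2 x"] t z12 at_bound[OF that]
      by (simp add: feasible_set_iff var_value_convex)
    then show ?thesis by (simp add: var_rate_diff_points[where b = b])
  qed
  then have "z1 - z2 = (\<Sum>j\<in>nb_free I. (z1 - z2) $ j *\<^sub>R free_direction A I j)"
    by (rule free_direction_decomposition[OF us part])
  then have "z1 - z2 \<in> span (free_direction A I ` nb_free I)"
    by (metis (no_types, lifting) imageI span_base span_scale span_sum)
  \<comment> \<open>Both displacements are multiples of \<open>z1 - z2\<close>, so one membership in
    the span settles both claims.\<close>
  moreover have "z - z1 = (t - 1) *\<^sub>R (z1 - z2)" "z - z2 = t *\<^sub>R (z1 - z2)"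
    using t by (auto simp: algebra_simps)
  ultimately show "z - z1 \<in> lineality_space ?C" "z - z2 \<in> lineality_space ?C"
    using span_free_directions_eq_lineality_space[OF inv terminal] span_scale by metis+
qed

theorem proposition4p1:
  fixes A :: "real^'n^'m" and b :: "real^'m" and \<kappa> :: "'m \<Rightarrow> row_sense"
    and l u :: "'n \<Rightarrow> ereal"
    and z0 z :: "real^'n" and I0 I :: "('n, 'm) index_sets"
    and C :: "(real^'n) set"
  assumes C_def: "C = feasible_set A b \<kappa> l u"
    and nonzero_rows: "\<And>i. row i A \<noteq> 0"
    and no_fixed: "\<And>j. l j < u j"
    and nonempty: "C \<noteq> {}"
    and start: "basic_feasible_solution A b \<kappa> l u z0 I0"
    and result: "pivot_output A b \<kappa> l u (z0, I0) (z, I)"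
  shows "implicit_extreme_point z C \<and>
    dim (lineality_space C) = card (nb_free I) \<and>
    independent (free_direction A I ` nb_free I) \<and>
    span (free_direction A I ` nb_free I) = lineality_space C"
proof -
  have terminal: "\<nexists>s. pivot_step A b \<kappa> l u (z, I) s"
    using result by (simp add: pivot_output_def)
  have inv: "pivot_invariant A b \<kappa> l u z I"
    using pivot_invariant_steps[of A b \<kappa> l u "(z0, I0)" "(z, I)"] result
      pivot_invariant_basic_feasible_solution[OF start] by (simp add: pivot_output_def)
  then have part: "index_partition I" by (simp add: pivot_invariant_def)
  note span = span_free_directions_eq_lineality_space[OF inv terminal]
  have "dim (lineality_space C) = card (free_direction A I ` nb_free I)"
    unfolding C_def span[symmetric] dim_span
    by (rule dim_eq_card_independent[OF independent_free_directions[OF part]])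
  \<comment> \<open>Distinct indices give distinct directions, so counting the basis vectors counts
    the nonbasic free variables.\<close>
  also have "\<dots> = card (nb_free I)"
    by (rule card_image[OF inj_on_free_direction[OF part]])
  finally show ?thesis
    using implicit_extreme_point_terminal[OF inv terminal] independent_free_directions[OF part] span
    by (simp add: C_def)
qed

end
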